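(* For every $r\in\mathbb{N}$ the function $$K(x,j)=I_j(x),\qquad x\in\mathbb{R},\ x>0,\quad j\in\mathbb{Z}_{\geq 0},$$ where $I_j$ is the modified Bessel function of the first kind of index $j$, is a strictly totally positive kernel of order $r$ on $X\times Y$ with $X=\mathbb{R}_+=\{x\in\mathbb{R} : x>0\}$ and $Y=\mathbb{Z}_{\geq 0}$ (with their usual orders).
   Context: The modified Bessel functions of the first kind $I_j$, $j\in\mathbb{Z}$, are the Laurent coefficients in $$e^{\frac y2\left(z+\frac1z\right)}=\sum_{j=-\infty}^{+\infty}I_j(y)z^j;$$ equivalently, $I_j(y)=\frac1\pi\int_0^\pi e^{y\cos\phi}\cos(j\phi)\,d\phi$ for $j\in\mathbb{Z}$. A real-valued function $K(x,y)$ on a product $X\times Y$ of two totally ordered sets is called a strictly totally positive kernel of order $r\in\mathbb{N}$ if for every $1\leq m\leq r$, every $x_1<\dots<x_m$ in $X$ and every $y_1<\dots<y_m$ in $Y$ the determinant of the matrix $(K(x_i,y_j))_{i,j=1}^m$ is positive (strictly greater than $0$). *)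

theory Defs
  imports "HOL-Analysis.Analysis" "Jordan_Normal_Form.Determinant"
begin

definition is_bessel_I_coeffs :: "real \<Rightarrow> (int \<Rightarrow> real) \<Rightarrow> bool" where
  "is_bessel_I_coeffs y c \<longleftrightarrow>
     (\<forall>z::complex. z \<noteq> 0 \<longrightarrow>
        ((\<lambda>j. of_real (c j) * z powi j) has_sum exp (of_real y / 2 * (z + 1 / z))) UNIV)"

text \<open>The coefficient family exists and is unique; see \<open>bessel_I_coeffs_ex1\<close> below, so
  the description in the following definition is never vacuous.\<close>

definition bessel_I :: "int \<Rightarrow> real \<Rightarrow> real" where
  "bessel_I j y = (THE c. is_bessel_I_coeffs y c) j"

text \<open>Totally ordered sets are rendered as subsets of linearly ordered types, with the induced
  order. Only the entries \<open>x 0, \<dots>, x (m - 1)\<close> and \<open>y 0, \<dots>, y (m - 1)\<close> matter. The qualified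
  name is the determinant of matrices whose dimension \<open>m\<close> is a number rather than a type.\<close>

definition strictly_totally_positive_kernel ::
    "nat \<Rightarrow> 'a::linorder set \<Rightarrow> 'b::linorder set \<Rightarrow> ('a \<Rightarrow> 'b \<Rightarrow> real) \<Rightarrow> bool" where
  "strictly_totally_positive_kernel r X Y K \<longleftrightarrow>
     (\<forall>m (x :: nat \<Rightarrow> 'a) (y :: nat \<Rightarrow> 'b).
        1 \<le> m \<and> m \<le> r
        \<and> x ` {..<m} \<subseteq> X \<and> strict_mono_on {..<m} x
        \<and> y ` {..<m} \<subseteq> Y \<and> strict_mono_on {..<m} y
        \<longrightarrow> 0 < Determinant.det (mat m m (\<lambda>(i, j). K (x i) (y j))))"

lemma integral_cos_int:
  "integral {0..pi} (\<lambda>t. cos (of_int n * t)) = (if n = 0 then pi else 0)"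
proof (cases "n = 0")
  case False
  have "((\<lambda>t. cos (of_int n * t)) has_integral
      (sin (of_int n * pi) / of_int n - sin (of_int n * 0) / of_int n)) {0..pi}"
    using False
    by (intro fundamental_theorem_of_calculus)
       (auto simp: has_real_derivative_iff_has_vector_derivative [symmetric]
             intro!: derivative_eq_intros)
  moreover have "sin (of_int n * pi) = 0"
    by (simp add: sin_zero_iff_int2)
  ultimately show ?thesis
    using False by (simp add: integral_unique)
qed simp

lemma bessel_I_coeffs_integral:
  assumes "is_bessel_I_coeffs y c"
  shows "c k = 1 / pi * integral {0..pi} (\<lambda>t. exp (y * cos t) * cos (of_int k * t))"
proof -
  have s1: "((\<lambda>j. complex_of_real (c j) * cis t powi j) has_sum
      exp (of_real y / 2 * (cis t + 1 / cis t))) UNIV" for t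
    using assms unfolding is_bessel_I_coeffs_def by simp
  have powi_cis: "cis t powi j = cis (of_int j * t)" for j t
    by (simp add: cis_power_int)
  have e: "exp (of_real y / 2 * (cis t + 1 / cis t)) = of_real (exp (y * cos t))" for t
  proof -
    have "cis t + 1 / cis t = 2 * complex_of_real (cos t)"
      by (simp add: divide_inverse complex_eq_iff)
    then have "of_real y / 2 * (cis t + 1 / cis t) = complex_of_real (y * cos t)"
      by simp
    then show ?thesis by (simp only: exp_of_real)
  qed
  have pt: "((\<lambda>j. c j * cos (of_int (j - k) * t)) has_sum exp (y * cos t) * cos (of_int k * t)) UNIV" for t
  proof -
    have "((\<lambda>j. Re (cis (- (of_int k * t)) * (of_real (c j) * cis (of_int j * t)))) has_sum
        Re (cis (- (of_int k * t)) * of_real (exp (y * cos t)))) UNIV"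
      using s1[of t] unfolding powi_cis e by (intro has_sum_Re has_sum_cmult_right)
    moreover have "Re (cis (- (of_int k * t)) * (of_real (c j) * cis (of_int j * t)))
        = c j * cos (of_int (j - k) * t)" for j
      by (simp add: left_diff_distrib cos_diff algebra_simps)
    ultimately show ?thesis by (simp add: mult.commute)
  qed
  have "(\<lambda>j. complex_of_real (c j)) summable_on UNIV"
    using s1[of 0] by (auto simp: powi_cis summable_on_def)
  then have "(\<lambda>j. norm (c j)) summable_on UNIV"
    by (simp add: summable_on_iff_abs_summable_on_complex)
  then have "uniform_limit {0..pi} (\<lambda>F t. \<Sum>j\<in>F. c j * cos (of_int (j - k) * t))
      (\<lambda>t. infsum (\<lambda>j. c j * cos (of_int (j - k) * t)) UNIV) (finite_subsets_at_top UNIV)"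
    by (intro Weierstrass_m_test_general[where M = "\<lambda>j. norm (c j)"])
       (auto simp: abs_mult mult_left_le)
  moreover have "infsum (\<lambda>j. c j * cos (of_int (j - k) * t)) UNIV
      = exp (y * cos t) * cos (of_int k * t)" for t
    using pt by (rule infsumI)
  ultimately have ul: "uniform_limit {0..pi} (\<lambda>F t. \<Sum>j\<in>F. c j * cos (of_int (j - k) * t))
      (\<lambda>t. exp (y * cos t) * cos (of_int k * t)) (finite_subsets_at_top UNIV)"
    by simp
  obtain I J where IJ:
    "\<And>F. ((\<lambda>t. \<Sum>j\<in>F. c j * cos (of_int (j - k) * t)) has_integral I F) {0..pi}"
    "((\<lambda>t. exp (y * cos t) * cos (of_int k * t)) has_integral J) {0..pi}"
    "(I \<longlongrightarrow> J) (finite_subsets_at_top UNIV)"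
    by (rule uniform_limit_integral[OF ul]) (auto intro!: continuous_intros)
  have "I F = (if k \<in> F then pi * c k else 0)" if "finite F" for F
  proof -
    have "I F = integral {0..pi} (\<lambda>t. \<Sum>j\<in>F. c j * cos (of_int (j - k) * t))"
      using IJ(1)[of F] by (simp add: integral_unique)
    also have "\<dots> = (\<Sum>j\<in>F. integral {0..pi} (\<lambda>t. c j * cos (of_int (j - k) * t)))"
      using that by (intro integral_sum integrable_continuous_real) (auto intro!: continuous_intros)
    also have "\<dots> = (\<Sum>j\<in>F. if j = k then pi * c k else 0)"
      by (intro sum.cong refl) (use integral_cos_int in \<open>auto simp del: of_int_diff\<close>)
    finally show ?thesis using that by simp
  qed
  then have "\<forall>\<^sub>F F in finite_subsets_at_top UNIV. I F = pi * c k"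
    by (intro eventually_finite_subsets_at_top[THEN iffD2] exI[of _ "{k}"]) auto
  then have "(I \<longlongrightarrow> pi * c k) (finite_subsets_at_top UNIV)"
    by (rule tendsto_eventually)
  then have "J = pi * c k"
    using IJ(3) tendsto_unique finite_subsets_at_top_neq_bot by blast
  then show ?thesis
    using IJ(2) by (simp add: integral_unique)
qed

lemma bessel_I_coeffs_exist: "\<exists>c. is_bessel_I_coeffs y c"
proof -
  define g where "g = (\<lambda>(m, n). (y / 2) ^ m / fact m * ((y / 2) ^ n / fact n) :: real)"
  define A where "A = (\<lambda>j::int. {(m, n). int m - int n = j})"
  define c where "c j = infsum g (A j)" for j
  have exp_hs: "((\<lambda>n. w ^ n / fact n) has_sum exp w) UNIV"
    and exp_as: "(\<lambda>n. norm (w ^ n / fact n)) summable_on UNIV" for w :: complex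
  proof -
    have "summable (\<lambda>n. norm (w ^ n / fact n))"
      using summable_norm_exp[of w] by (simp add: scaleR_conv_of_real divide_simps)
    then show "(\<lambda>n. norm (w ^ n / fact n)) summable_on UNIV"
      using norm_summable_imp_summable_on[of "\<lambda>n. norm (w ^ n / fact n)"] by simp
    have "(\<lambda>n. w ^ n / fact n) sums exp w"
      using exp_converges[of w] by (simp add: scaleR_conv_of_real divide_simps)
    with \<open>summable _\<close> show "((\<lambda>n. w ^ n / fact n) has_sum exp w) UNIV"
      by (intro norm_summable_imp_has_sum)
  qed
  have "is_bessel_I_coeffs y c"
    unfolding is_bessel_I_coeffs_def
  proof (intro allI impI)
    fix z :: complex assume z: "z \<noteq> 0"
    define a where "a = of_real y / 2 * z"
    define b where "b = of_real y / 2 / z"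
    define f where "f = (\<lambda>(m, n). a ^ m / fact m * (b ^ n / fact n) :: complex)"
    have "(\<lambda>p. norm (f p)) summable_on UNIV \<times> UNIV"
      unfolding Infinite_Sum.abs_summable_on_Sigma_iff
    proof (intro conjI ballI)
      show "(\<lambda>n. norm (f (m, n))) summable_on UNIV" for m
        unfolding f_def prod.case norm_mult by (rule summable_on_cmult_right[OF exp_as])
      have "(\<Sum>\<^sub>\<infinity>n. norm (f (m, n))) =
          norm (a ^ m / fact m) * (\<Sum>\<^sub>\<infinity>n. norm (b ^ n / fact n))" for m
        unfolding f_def prod.case norm_mult by (rule infsum_cmult_right')
      moreover have "(\<lambda>m. norm (a ^ m / fact m) * (\<Sum>\<^sub>\<infinity>n. norm (b ^ n / fact n))) summable_on UNIV"
        by (rule summable_on_cmult_left[OF exp_as])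
      ultimately show "(\<lambda>m. norm (\<Sum>\<^sub>\<infinity>n. norm (f (m, n)))) summable_on UNIV"
        by (simp only: real_norm_def abs_of_nonneg infsum_nonneg norm_ge_zero abs_mult abs_norm_cancel)
    qed
    then have fs: "f summable_on UNIV \<times> UNIV"
      by (rule abs_summable_summable)
    have "infsum f (UNIV \<times> UNIV) = (\<Sum>\<^sub>\<infinity>m. \<Sum>\<^sub>\<infinity>n. f (m, n))"
      by (rule infsum_Sigma_banach [OF fs, symmetric])
    also have "\<dots> = exp a * exp b"
      by (simp only: f_def prod.case infsum_cmult_right' infsum_cmult_left' infsumI[OF exp_hs])
    also have "\<dots> = exp (of_real y / 2 * (z + 1 / z))"
      by (simp add: a_def b_def exp_add [symmetric] ring_distribs add_divide_distrib ac_simps)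
    finally have fh: "(f has_sum exp (of_real y / 2 * (z + 1 / z))) UNIV"
      using fs by (metis UNIV_Times_UNIV has_sum_infsum)
    have fh2: "((\<lambda>(j, p). f p) has_sum exp (of_real y / 2 * (z + 1 / z))) (SIGMA j:UNIV. A j)"
    proof -
      have "bij_betw snd (SIGMA j:UNIV. A j) UNIV"
        unfolding bij_betw_def by (auto simp: A_def inj_on_def image_iff)
      from has_sum_reindex_bij_betw[OF this, of f] fh show ?thesis
        by (simp add: case_prod_unfold)
    qed
    have fg: "f p = of_real (g p) * z powi j" if "p \<in> A j" for j p
    proof -
      obtain m n where p: "p = (m, n)" by fastforce
      then have j: "j = int m - int n" using that by (simp add: A_def)
      show ?thesis
        using z by (simp add: p j f_def g_def a_def b_def power_int_diff power_mult_distrib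
            power_divide ac_simps)
    qed
    have inner: "((\<lambda>p. f p) has_sum of_real (c j) * z powi j) (A j)" for j
    proof -
      have "f summable_on A j"
        using fs by (rule summable_on_subset_banach) auto
      then have "(\<lambda>p. of_real (g p) * z powi j) summable_on A j"
        using fg by (metis (no_types, lifting) summable_on_cong)
      then have "(\<lambda>p. complex_of_real (g p)) summable_on A j"
        using z by (simp add: summable_on_cmult_left')
      then have "g summable_on A j"
        using summable_on_Re by fastforce
      then have "(g has_sum c j) (A j)"
        unfolding c_def by (rule has_sum_infsum)
      then have "((\<lambda>p. of_real (g p) * z powi j) has_sum of_real (c j) * z powi j) (A j)"
        by (intro has_sum_cmult_left has_sum_of_real)
      then show ?thesis
        by (subst has_sum_cong[OF fg])
    qed
    show "((\<lambda>j. of_real (c j) * z powi j) has_sum exp (of_real y / 2 * (z + 1 / z))) UNIV"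
      using has_sum_SigmaD[OF fh2, of "\<lambda>j. of_real (c j) * z powi j"] inner by simp
  qed
  then show ?thesis by (rule exI[of _ c])
qed

lemma bessel_I_coeffs_ex1: "\<exists>!c. is_bessel_I_coeffs y c"
proof (rule ex_ex1I[OF bessel_I_coeffs_exist])
  fix c d assume "is_bessel_I_coeffs y c" "is_bessel_I_coeffs y d"
  then have "c k = d k" for k
    using bessel_I_coeffs_integral[of y c k] bessel_I_coeffs_integral[of y d k] by metis
  then show "c = d" by (rule ext)
qed

lemma bessel_I_coeffs: "is_bessel_I_coeffs y (\<lambda>j. bessel_I j y)"
  unfolding bessel_I_def using theI'[OF bessel_I_coeffs_ex1] by simp

lemma bessel_I_generating:
  fixes z :: complex
  assumes "z \<noteq> 0"
  shows "((\<lambda>j. of_real (bessel_I j y) * z powi j) has_sum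
           exp (of_real y / 2 * (z + 1 / z))) UNIV"
  using bessel_I_coeffs assms unfolding is_bessel_I_coeffs_def by blast

lemma bessel_I_integral:
  "bessel_I j y = 1 / pi * integral {0..pi} (\<lambda>t. exp (y * cos t) * cos (of_int j * t))"
  using bessel_I_coeffs_integral[OF bessel_I_coeffs] .

end

theory Submission
  imports Defs
begin

text \<open>Up to the positive factors \<open>exp x\<close> and \<open>(2n)! / n!\<^sup>3\<close>, the function \<open>I\<^sub>j x\<close> is the
  power series in \<open>x / 2\<close> with coefficients \<open>R\<^sub>j n = (\<Prod>i<j. (n - i) / (n + 1 + i))\<close>. The forward
  difference of a product of this shape is a positive multiple of another one with \<open>j\<close> lowered by
  one, so a discrete version of Rolle's theorem shows that a linear combination of \<open>m + 1\<close> of the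
  sequences \<open>R\<^sub>j\<close> has at most \<open>m\<close> sign changes. By Descartes' rule of signs a nontrivial combination
  of \<open>m + 1\<close> functions \<open>I\<^sub>j\<close> has at most \<open>m\<close> positive zeros. As a function of its smallest argument
  \<open>x 0\<close> the determinant is such a combination. It vanishes at \<open>x 1, \<dots>, x m\<close>, hence nowhere on
  \<open>(0, x 1)\<close>, and it is positive near \<open>0\<close> because there the cofactor of the smallest index dominates,
  which is positive by induction.\<close>

section \<open>Sign changes of real sequences\<close>

text \<open>A sequence with at most \<open>s\<close> sign changes is cut into \<open>s + 1\<close>
  consecutive blocks of weakly constant sign, the last one infinite. Zeros fit either sign and a
  block may be empty (\<open>N = 0\<close>), which makes this "at most" rather than
  "exactly".\<close>

primrec sign_changes_le :: "nat \<Rightarrow> (nat \<Rightarrow> real) \<Rightarrow> bool" where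
  "sign_changes_le 0 u \<longleftrightarrow> (\<forall>n. 0 \<le> u n) \<or> (\<forall>n. u n \<le> 0)"
| "sign_changes_le (Suc s) u \<longleftrightarrow>
     (\<exists>N. ((\<forall>n<N. 0 \<le> u n) \<or> (\<forall>n<N. u n \<le> 0)) \<and> sign_changes_le s (\<lambda>n. u (n + N)))"

lemma sign_changes_le_uminus: "sign_changes_le s u \<Longrightarrow> sign_changes_le s (\<lambda>n. - u n)"
proof (induction s arbitrary: u)
  case (Suc s)
  then obtain N where "(\<forall>n<N. 0 \<le> u n) \<or> (\<forall>n<N. u n \<le> 0)" "sign_changes_le s (\<lambda>n. u (n + N))"
    by auto
  then show ?case using Suc.IH by (auto intro!: exI[of _ N])
qed auto

lemma sign_changes_le_mult_pos:
  assumes "\<And>n. 0 < w n" "sign_changes_le s u"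
  shows "sign_changes_le s (\<lambda>n. w n * u n)"
  using assms
proof (induction s arbitrary: u w)
  case 0
  then show ?case by (auto simp: zero_le_mult_iff mult_le_0_iff less_imp_le)
next
  case (Suc s)
  then obtain N where N: "(\<forall>n<N. 0 \<le> u n) \<or> (\<forall>n<N. u n \<le> 0)"
    "sign_changes_le s (\<lambda>n. u (n + N))" by auto
  have "sign_changes_le s (\<lambda>n. w (n + N) * u (n + N))"
    by (rule Suc.IH) (use Suc.prems N in auto)
  moreover have "(\<forall>n<N. 0 \<le> w n * u n) \<or> (\<forall>n<N. w n * u n \<le> 0)"
    using N(1) Suc.prems(1) by (auto simp: zero_le_mult_iff mult_le_0_iff less_imp_le)
  ultimately show ?case by auto
qed

text \<open>Leading zeros have either weak sign, so the first block absorbs them. This handles the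
  indices below the smallest \<open>y l\<close>, where all falling ratios vanish.\<close>

lemma sign_changes_le_shift:
  assumes "\<And>n. n < k \<Longrightarrow> u n = 0" "sign_changes_le s (\<lambda>n. u (n + k))"
  shows "sign_changes_le s u"
proof -
  have split: "(\<forall>n<N + k. P (u n)) \<longleftrightarrow> (\<forall>n<N. P (u (n + k)))" if "P 0" for P N
    using that assms(1)
    by (metis add_less_cancel_right le_add_diff_inverse2 not_le)
  show ?thesis
  proof (cases s)
    case 0
    have "P (u n)" if "P 0" "\<And>n. P (u (n + k))" for P n
      using that assms(1) by (metis le_add_diff_inverse2 not_le)
    from this[of "\<lambda>v. 0 \<le> v"] this[of "\<lambda>v. v \<le> 0"] show ?thesis
      using assms(2) by (auto simp: 0)
  next
    case (Suc t)
    then obtain N where N: "(\<forall>n<N. 0 \<le> u (n + k)) \<or> (\<forall>n<N. u (n + k) \<le> 0)"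
      "sign_changes_le t (\<lambda>n. u (n + N + k))" using assms(2) by auto
    then show ?thesis
      unfolding Suc sign_changes_le.simps
      by (intro exI[of _ "N + k"]) (simp add: split[of "\<lambda>v. 0 \<le> v"] split[of "\<lambda>v. v \<le> 0"] add.assoc)
  qed
qed

text \<open>Once a nondecreasing stretch becomes positive it stays so. The endpoint \<open>N\<close>
  is included in order to force the sign of the block that starts there.\<close>

lemma monotone_first_positive:
  fixes u :: "nat \<Rightarrow> real"
  assumes "\<And>n. n < N \<Longrightarrow> u n \<le> u (Suc n)" "\<not> (\<forall>n<N. u n \<le> 0)"
  obtains M where "M < N" "\<forall>n<M. u n \<le> 0" "\<forall>n. M \<le> n \<and> n \<le> N \<longrightarrow> 0 < u n"
proof -
  from assms(2) obtain n where n: "n < N" "0 < u n" by (auto simp: not_le)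
  define M where "M = (LEAST n. 0 < u n)"
  have M: "0 < u M" "M \<le> n" unfolding M_def using n by (auto intro: LeastI Least_le)
  have "u M \<le> u i" if "M \<le> i" "i \<le> N" for i
    using that
  proof (induction i rule: dec_induct)
    case (step i)
    then show ?case using assms(1)[of i] by simp
  qed simp
  then have "\<forall>n. M \<le> n \<and> n \<le> N \<longrightarrow> 0 < u n" using M by (meson order.strict_trans2)
  moreover have "\<forall>n<M. u n \<le> 0" unfolding M_def by (auto dest: not_less_Least)
  moreover have "M < N" using M n by simp
  ultimately show thesis using that by blast
qed

lemma sign_changes_le_mono:
  assumes "\<And>n. u n \<le> u (Suc n)"
  shows "sign_changes_le 1 u"
proof (cases "\<forall>n. u n \<le> 0")
  case True
  then show ?thesis by auto
next
  case False
  then obtain K where K: "0 < u K" by (auto simp: not_le)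
  \<comment> \<open>The bound is \<open>Suc K\<close> because a positive term is needed strictly
    below it.\<close>
  from monotone_first_positive[of "Suc K" u] assms K obtain M where
    M: "M < Suc K" "\<forall>n<M. u n \<le> 0" "\<forall>n. M \<le> n \<and> n \<le> Suc K \<longrightarrow> 0 < u n"
    by (metis lessI not_le)
  have "u M \<le> u (n + M)" for n
    using assms lift_Suc_mono_le[of u M "n + M"] by auto
  moreover have "0 < u M" using M by auto
  ultimately have "\<forall>n. 0 \<le> u (n + M)" by (meson less_imp_le order_trans)
  then show ?thesis using M(2) by auto
qed

text \<open>A nondecreasing head costs only one extra block. If it never becomes positive before
  \<open>N\<close>, it is itself that block. Otherwise it splits at \<open>M\<close>, and its
  positive part merges with the first block of the tail.\<close>

lemma sign_changes_le_join:
  assumes mono: "\<And>n. n < N \<Longrightarrow> u n \<le> u (Suc n)"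
    and tail: "sign_changes_le (Suc s) (\<lambda>n. u (n + N))"
  shows "sign_changes_le (Suc (Suc s)) u"
proof (cases "\<forall>n<N. u n \<le> 0")
  case True
  then show ?thesis using tail by (auto simp only: sign_changes_le.simps(2)[of "Suc s"])
next
  case False
  from monotone_first_positive[OF mono False] obtain M where
    M: "M < N" "\<forall>n<M. u n \<le> 0" "\<forall>n. M \<le> n \<and> n \<le> N \<longrightarrow> 0 < u n" .
  from tail obtain N' where
    N': "(\<forall>n<N'. 0 \<le> u (n + N)) \<or> (\<forall>n<N'. u (n + N) \<le> 0)"
    "sign_changes_le s (\<lambda>n. u (n + N' + N))" by auto
  \<comment> \<open>If the first tail block is nonempty it contains \<open>u N\<close>, which is
    positive, so the block cannot be the nonpositive kind.\<close>
  have nonneg: "0 \<le> u (n + N)" if "n < N'" for n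
    proof -
    have "0 < u (0 + N)" using M by auto
    moreover have "0 < N'" using that by simp
    ultimately show ?thesis using N'(1) that by (metis not_le)
  qed
  have "0 \<le> u (n + M)" if "n < N - M + N'" for n
  proof (cases "n + M \<le> N")
    case True
    then show ?thesis using M(3) by (simp add: less_imp_le)
  next
    case False
    then show ?thesis using nonneg[of "n + M - N"] that M(1) by simp
  qed
  moreover have "sign_changes_le s (\<lambda>n. u (n + (N - M + N') + M))"
    using N'(2) M(1) by (simp add: algebra_simps)
  ultimately have "sign_changes_le (Suc s) (\<lambda>n. u (n + M))" by auto
  then show ?thesis using M(2) by (auto simp only: sign_changes_le.simps(2)[of "Suc s"])
qed

text \<open>A discrete Rolle theorem. On each block of the difference \<open>u\<close> is monotone,
  so the blocks are joined one at a time from the right; a nonincreasing block is reduced to the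
  other kind by negation.\<close>

lemma sign_changes_le_difference:
  assumes "sign_changes_le s (\<lambda>n. u (Suc n) - u n)"
  shows "sign_changes_le (Suc s) u"
  using assms
proof (induction s arbitrary: u)
  case 0
  then consider "\<And>n. u n \<le> u (Suc n)" | "\<And>n. - u n \<le> - u (Suc n)" by force
  then show ?case
    by cases (use sign_changes_le_mono[of u] sign_changes_le_mono[of "\<lambda>n. - u n"]
        sign_changes_le_uminus[of 1 "\<lambda>n. - u n"] in \<open>auto simp del: sign_changes_le.simps\<close>)
next
  case (Suc s)
  then obtain N where N: "(\<forall>n<N. 0 \<le> u (Suc n) - u n) \<or> (\<forall>n<N. u (Suc n) - u n \<le> 0)"
    "sign_changes_le s (\<lambda>n. u (Suc n + N) - u (n + N))" by auto
  note tail = Suc.IH[of "\<lambda>n. u (n + N)", OF N(2)]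
  from N(1) show ?case
  proof
    assume "\<forall>n<N. 0 \<le> u (Suc n) - u n"
    then show ?thesis by (intro sign_changes_le_join[of N] tail) auto
  next
    assume "\<forall>n<N. u (Suc n) - u n \<le> 0"
    then have "sign_changes_le (Suc (Suc s)) (\<lambda>n. - u n)"
      by (intro sign_changes_le_join[of N] sign_changes_le_uminus[OF tail]) auto
    from sign_changes_le_uminus[OF this] show ?thesis by simp
  qed
qed

text \<open>A polynomial with one root between neighbouring blocks compensates the sign changes. Its
  roots \<open>k - 1 / 2\<close> are half-integers, so it vanishes at no natural number and each
  factor can later multiply the coefficients without killing any.\<close>

lemma sign_changes_le_polynomial:
  assumes "sign_changes_le s u"
  obtains xs :: "nat list" and e :: real where "length xs \<le> s"
    "\<And>n. 0 \<le> e * (\<Prod>k\<leftarrow>xs. real n - real k + 1 / 2) * u n" "e \<noteq> 0"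
  using assms
proof (induction s arbitrary: u thesis)
  case 0
  then show ?case using "0.prems"(1)[of "[]" 1] "0.prems"(1)[of "[]" "-1"] by auto
next
  case (Suc s)
  from Suc.prems(2) obtain N where
    N: "(\<forall>n<N. 0 \<le> u n) \<or> (\<forall>n<N. u n \<le> 0)" "sign_changes_le s (\<lambda>n. u (n + N))" by auto
  from Suc.IH[OF _ N(2)] obtain xs e where xs: "length xs \<le> s" "e \<noteq> 0"
    "\<And>n. 0 \<le> e * (\<Prod>k\<leftarrow>xs. real n - real k + 1 / 2) * u (n + N)" by blast
  define P where "P n = (\<Prod>k\<leftarrow>map (\<lambda>k. k + N) xs. real n - real k + 1 / 2)" for n
  have P_tail: "0 \<le> e * P n * u n" if "N \<le> n" for n
    using xs(3)[of "n - N"] that by (simp add: P_def o_def of_nat_diff algebra_simps)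
  \<comment> \<open>Left of \<open>N\<close> every factor is negative, since all roots are at least
    \<open>N - 1 / 2\<close>.\<close>
  have P_head: "0 < (- 1) ^ length xs * P n" if "n < N" for n
    using that unfolding P_def by (induction xs) (auto simp: mult_less_0_iff zero_less_mult_iff)
  define s0 where "s0 = (if \<forall>n<N. 0 \<le> u n then 1 else - 1 :: real)"
  have s0: "0 \<le> s0 * u n" if "n < N" for n using N(1) that by (auto simp: s0_def)
  have head: "0 \<le> (- 1) ^ length xs * s0 * P n * u n" if "n < N" for n
    using mult_nonneg_nonneg[OF less_imp_le[OF P_head[OF that]] s0[OF that]]
    by (simp add: mult_ac)
  show ?case
  \<comment> \<open>If the polynomial of the tail already gives the head the sign prescribed by
    \<open>e\<close>, no root is added. Otherwise a root at \<open>N - 1 / 2\<close> flips the head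
    and leaves the tail alone.\<close>
  proof (cases "0 < (- 1) ^ length xs * s0 * e")
    case True
    have "0 \<le> e * P n * u n" for n
    proof (cases "n < N")
      case l: True
      have "0 \<le> ((- 1) ^ length xs * s0 * e) * ((- 1) ^ length xs * s0 * P n * u n)"
        using True head[OF l] by simp
      also have "\<dots> = e * P n * u n * ((- 1) ^ length xs)\<^sup>2 * s0\<^sup>2"
        by (simp add: power2_eq_square)
      also have "\<dots> = e * P n * u n" by (simp add: s0_def flip: power_mult)
      finally show ?thesis .
    qed (use P_tail in simp)
    then show ?thesis using Suc.prems(1)[of "map (\<lambda>k. k + N) xs" e] xs unfolding P_def by auto
  next
    case False
    then have neg: "(- 1) ^ length xs * s0 * e < 0"
      using xs(2) by (cases "even (length xs)") (auto simp: s0_def split: if_splits)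
    have "0 \<le> e * ((real n - real N + 1 / 2) * P n) * u n" for n
    proof (cases "n < N")
      case l: True
      have "0 \<le> (- ((- 1) ^ length xs * s0 * e)) * ((- 1) ^ length xs * s0 * P n * u n)"
        using neg by (intro mult_nonneg_nonneg[OF _ head[OF l]]) auto
      also have "\<dots> = - (e * P n * u n) * ((- 1) ^ length xs)\<^sup>2 * s0\<^sup>2"
        by (simp add: power2_eq_square)
      also have "\<dots> = - (e * P n * u n)" by (simp add: s0_def flip: power_mult)
      finally have "0 \<le> (real N - real n - 1 / 2) * (- (e * P n * u n))"
        using l by (intro mult_nonneg_nonneg) auto
      then show ?thesis by (simp add: algebra_simps)
    next
      case g: False
      have "0 \<le> (real n - real N + 1 / 2) * (e * P n * u n)"
        using g by (intro mult_nonneg_nonneg P_tail) auto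
      then show ?thesis by (simp add: algebra_simps)
    qed
    then show ?thesis
      using Suc.prems(1)[of "N # map (\<lambda>k. k + N) xs" e] xs unfolding P_def by auto
  qed
qed

section \<open>Linear combinations of falling ratios\<close>

text \<open>A falling factorial over a rising one. The case \<open>\<sigma> = 1\<close> is the
  sequence of the Bessel coefficients; the parameter is there because factoring and differencing
  both raise it.\<close>

definition falling_ratio :: "real \<Rightarrow> nat \<Rightarrow> nat \<Rightarrow> real" where
  "falling_ratio \<sigma> j n = (\<Prod>i<j. (real n - real i) / (real n + \<sigma> + real i))"

lemma falling_ratio_eq_0: "n < j \<Longrightarrow> falling_ratio \<sigma> j n = 0"
  unfolding falling_ratio_def by (intro prod_zero) auto

lemma falling_ratio_pos: "j \<le> n \<Longrightarrow> 0 < \<sigma> \<Longrightarrow> 0 < falling_ratio \<sigma> j n"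
  unfolding falling_ratio_def by (intro prod_pos ballI divide_pos_pos) auto

text \<open>For the factors with \<open>i = k + i'\<close>, moving the argument by \<open>k\<close>
  cancels \<open>k\<close> in the numerator and doubles it in the denominator.\<close>

lemma falling_ratio_add:
  "falling_ratio \<sigma> (k + d) (n + k) = falling_ratio \<sigma> k (n + k) * falling_ratio (\<sigma> + 2 * real k) d n"
  by (induction d) (simp_all add: falling_ratio_def algebra_simps)

text \<open>Both terms are rational multiples of \<open>falling_ratio (\<sigma> + 2) e n\<close>,
  and \<open>(n + 1) * (n + \<sigma>) - (n - e) * (n + \<sigma> + e + 1) = (e + 1) * (e +
  \<sigma>)\<close> no longer depends on \<open>n\<close>.\<close>

lemma falling_ratio_difference:
  assumes "0 < \<sigma>"
  shows "falling_ratio \<sigma> (Suc e) (Suc n) - falling_ratio \<sigma> (Suc e) n =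
    (real e + 1) * (real e + \<sigma>) / ((real n + \<sigma>) * (real n + \<sigma> + 1)) * falling_ratio (\<sigma> + 2) e n"
proof -
  define P where "P = falling_ratio (\<sigma> + 2) e n"
  have 1: "falling_ratio \<sigma> (Suc e) (Suc n) = P * ((real n + 1) / (real n + \<sigma> + 1))"
  proof -
    have "(\<Prod>i<Suc e. real (Suc n) - real i) = (real n + 1) * (\<Prod>i<e. real n - real i)"
      by (subst prod.lessThan_Suc_shift) simp
    moreover have "(\<Prod>i<Suc e. real (Suc n) + \<sigma> + real i) =
        (real n + \<sigma> + 1) * (\<Prod>i<e. real n + (\<sigma> + 2) + real i)"
      by (subst prod.lessThan_Suc_shift) (simp add: algebra_simps)
    ultimately show ?thesis
      unfolding P_def falling_ratio_def prod_dividef by (simp only: times_divide_times_eq mult_ac)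
  qed
  have 2: "falling_ratio \<sigma> (Suc e) n = P * ((real n - real e) * (real n + \<sigma> + real e + 1)
      / ((real n + \<sigma>) * (real n + \<sigma> + 1)))"
    unfolding P_def
  proof (induction e)
    case 0
    have "real n + \<sigma> + 1 \<noteq> 0" using assms by linarith
    then show ?case by (simp add: falling_ratio_def)
  next
    case (Suc e)
    have nz: "real n + \<sigma> + real e + 1 \<noteq> 0" "real n + \<sigma> + real e + 2 \<noteq> 0"
      using assms by linarith+
    have "falling_ratio \<sigma> (Suc (Suc e)) n =
        falling_ratio \<sigma> (Suc e) n * ((real n - real (Suc e)) / (real n + \<sigma> + real (Suc e)))"
      by (simp add: falling_ratio_def)
    moreover have "falling_ratio (\<sigma> + 2) (Suc e) n =
        falling_ratio (\<sigma> + 2) e n * ((real n - real e) / (real n + \<sigma> + real e + 2))"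
      by (simp add: falling_ratio_def algebra_simps)
    moreover have "p * (a * q / d) * (b / q) = p * (a / t) * (b * t / d)"
      if "q \<noteq> 0" "t \<noteq> 0" for p a q b t d :: real
      using that by simp
    from this[OF nz] have "falling_ratio (\<sigma> + 2) e n * ((real n - real e) * (real n + \<sigma> + real e + 1)
        / ((real n + \<sigma>) * (real n + \<sigma> + 1))) * ((real n - real (Suc e)) / (real n + \<sigma> + real e + 1)) =
        falling_ratio (\<sigma> + 2) e n * ((real n - real e) / (real n + \<sigma> + real e + 2)) *
        ((real n - real (Suc e)) * (real n + \<sigma> + real e + 2) / ((real n + \<sigma>) * (real n + \<sigma> + 1)))" .
    ultimately show ?case
      unfolding Suc.IH by (simp add: add_ac)
  qed
  have nz: "real n + \<sigma> \<noteq> 0" "real n + \<sigma> + 1 \<noteq> 0" using assms by linarith+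
  show ?thesis
    unfolding 1 2 P_def[symmetric] using nz by (simp add: divide_simps) (simp add: algebra_simps)
qed

text \<open>Dividing by the ratio of the smallest index turns that term into a constant, which
  differencing removes. What remains is, up to a positive factor, a sum of the same shape with one
  term fewer and a larger \<open>\<sigma>\<close>; hence the induction over all
  \<open>\<sigma>\<close>.\<close>

lemma sign_changes_falling_ratio_sum:
  assumes "strict_mono_on {..m} y" "0 < \<sigma>"
  shows "sign_changes_le m (\<lambda>n. \<Sum>l\<le>m. c l * falling_ratio \<sigma> (y l) n)"
  using assms
proof (induction m arbitrary: y c \<sigma>)
  case 0
  have "0 \<le> falling_ratio \<sigma> (y 0) n" for n
    using falling_ratio_eq_0[of n "y 0" \<sigma>] falling_ratio_pos[of "y 0" n \<sigma>] 0 by (cases "n < y 0") auto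
  then show ?case by (cases "0 \<le> c 0") (auto simp: mult_nonpos_nonneg)
next
  case (Suc m)
  define k where "k = y 0"
  define \<tau> where "\<tau> = \<sigma> + 2 * real k"
  \<comment> \<open>The excess over \<open>k\<close>, lowered by one more in anticipation of the
    difference.\<close>
  define e where "e l = y (Suc l) - Suc k" for l
  have y_less: "y i < y j" if "i < j" "j \<le> Suc m" for i j
    using Suc.prems(1) that by (auto simp: strict_mono_on_def)
  have y_Suc: "y (Suc l) = k + Suc (e l)" if "l \<le> m" for l
    using y_less[of 0 "Suc l"] that by (simp add: e_def k_def)
  have e_mono: "strict_mono_on {..m} e"
  proof (intro strict_mono_onI)
    fix i j assume "i \<in> {..m}" "j \<in> {..m}" "i < j"
    then show "e i < e j" using y_less[of "Suc i" "Suc j"] y_Suc[of i] y_Suc[of j] by simp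
  qed
  have \<tau>: "0 < \<tau>" using Suc.prems by (simp add: \<tau>_def add_pos_nonneg)
  \<comment> \<open>The sum at \<open>n + k\<close> divided by
    \<open>falling_ratio \<sigma> k (n + k)\<close>, which is positive.\<close>
  define v where "v n = c 0 + (\<Sum>l\<le>m. c (Suc l) * falling_ratio \<tau> (Suc (e l)) n)" for n
  have "v (Suc n) - v n = 1 / ((real n + \<tau>) * (real n + \<tau> + 1)) *
      (\<Sum>l\<le>m. c (Suc l) * ((real (e l) + 1) * (real (e l) + \<tau>)) * falling_ratio (\<tau> + 2) (e l) n)" for n
  proof -
    have "v (Suc n) - v n =
        (\<Sum>l\<le>m. c (Suc l) * (falling_ratio \<tau> (Suc (e l)) (Suc n) - falling_ratio \<tau> (Suc (e l)) n))"
      by (simp add: v_def right_diff_distrib sum_subtractf)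
    then show ?thesis
      unfolding falling_ratio_difference[OF \<tau>] by (simp add: sum_distrib_left mult_ac)
  qed
  moreover have "sign_changes_le m (\<lambda>n. 1 / ((real n + \<tau>) * (real n + \<tau> + 1)) *
      (\<Sum>l\<le>m. c (Suc l) * ((real (e l) + 1) * (real (e l) + \<tau>)) * falling_ratio (\<tau> + 2) (e l) n))"
    by (intro sign_changes_le_mult_pos Suc.IH e_mono) (use \<tau> in \<open>auto intro: add_nonneg_pos add_pos_nonneg\<close>)
  ultimately have "sign_changes_le (Suc m) v"
    by (intro sign_changes_le_difference) simp
  then have "sign_changes_le (Suc m) (\<lambda>n. falling_ratio \<sigma> k (n + k) * v n)"
    by (intro sign_changes_le_mult_pos) (use falling_ratio_pos Suc.prems in auto)
  moreover have "falling_ratio \<sigma> k (n + k) * v n =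
      (\<Sum>l\<le>Suc m. c l * falling_ratio \<sigma> (y l) (n + k))" for n
    unfolding sum.atMost_Suc_shift v_def
    by (simp add: y_Suc falling_ratio_add \<tau>_def k_def[symmetric] sum_distrib_left distrib_left mult_ac
        del: add_Suc_right)
  ultimately have "sign_changes_le (Suc m) (\<lambda>n. \<Sum>l\<le>Suc m. c l * falling_ratio \<sigma> (y l) (n + k))"
    by simp
  moreover have "(\<Sum>l\<le>Suc m. c l * falling_ratio \<sigma> (y l) n) = 0" if "n < k" for n
  proof (intro sum.neutral ballI)
    fix l assume "l \<in> {..Suc m}"
    then have "k \<le> y l" using y_less[of 0 l] by (cases l) (auto simp: k_def)
    then show "c l * falling_ratio \<sigma> (y l) n = 0" using that by (simp add: falling_ratio_eq_0)
  qed
  ultimately show ?case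
    using sign_changes_le_shift[of k "\<lambda>n. \<Sum>l\<le>Suc m. c l * falling_ratio \<sigma> (y l) n"] by blast
qed

section \<open>Positive zeros of entire series\<close>

lemma Rolle_finite_zeros:
  fixes h h' :: "real \<Rightarrow> real"
  assumes der: "\<And>x. 0 < x \<Longrightarrow> (h has_real_derivative h' x) (at x)"
    and Z: "finite Z" "Z \<subseteq> {x. 0 < x \<and> h x = 0}"
  obtains Z' where "finite Z'" "Z' \<subseteq> {x. 0 < x \<and> h' x = 0}" "card Z \<le> Suc (card Z')"
proof -
  \<comment> \<open>Zeros are added in increasing order. The extra clause keeps \<open>Z'\<close>
    below the largest old zero, so the Rolle point found beyond that zero is new.\<close>
  have "\<exists>Z'. finite Z' \<and> Z' \<subseteq> {x. 0 < x \<and> h' x = 0} \<and> (\<forall>x\<in>Z'. \<exists>z\<in>Z. x < z) \<and> card Z \<le> Suc (card Z')"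
    using Z
  proof (induction Z rule: finite_linorder_max_induct)
    case empty
    show ?case by (intro exI[of _ "{}"]) auto
  next
    case (insert b A)
    from insert.IH insert.prems obtain Z' where Z': "finite Z'" "Z' \<subseteq> {x. 0 < x \<and> h' x = 0}"
      "\<forall>x\<in>Z'. \<exists>z\<in>A. x < z" "card A \<le> Suc (card Z')" by (metis insert_subset)
    show ?case
    proof (cases "A = {}")
      case True
      then show ?thesis by (intro exI[of _ "{}"]) auto
    next
      case False
      define a where "a = Max A"
      have "a \<in> A" unfolding a_def by (rule Max_in[OF insert.hyps(1) False])
      then have a: "a < b" "0 < a" "h a = 0" "h b = 0"
        using bspec[OF insert.hyps(2), of a] subsetD[OF insert.prems, of a] subsetD[OF insert.prems, of b]
        by simp_all
      have "\<exists>z>a. z < b \<and> (h has_real_derivative 0) (at z)"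
      proof (rule Rolle)
        show "continuous_on {a..b} h"
          using a by (auto intro!: DERIV_continuous_on[where D = h'] DERIV_subset[OF der])
        show "h differentiable (at x)" if "a < x" "x < b" for x
          using der[of x] that a unfolding real_differentiable_def by auto
      qed (use a in simp_all)
      then obtain z where z: "a < z" "z < b" "(h has_real_derivative 0) (at z)" by blast
      have "h' z = 0" using DERIV_unique[OF der z(3)] a z by simp
      moreover have "z \<notin> Z'"
      proof
        assume "z \<in> Z'"
        then obtain w where w: "w \<in> A" "z < w" using Z' by blast
        show False using z(1) w(2) Max_ge[OF insert.hyps(1) w(1)] by (simp add: a_def)
      qed
      ultimately show ?thesis
        using Z' z a insert(1)
        by (intro exI[of _ "insert z Z'"]) (auto simp: card_insert_if intro: less_trans)
    qed
  qed
  then show thesis using that by blast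
qed

text \<open>The Descartes rule of signs for entire series: passing from \<open>f\<close> to
  \<open>x powr (1 + \<alpha>) * (x powr - \<alpha> * f x)'\<close> multiplies the \<open>n\<close>-th coefficient by \<open>n - \<alpha>\<close>.\<close>

lemma Descartes_powser:
  fixes a :: "nat \<Rightarrow> real" and xs :: "nat list"
  assumes "\<And>x. summable (\<lambda>n. a n * x ^ n)"
    and "\<And>n. 0 \<le> e * (\<Prod>k\<leftarrow>xs. real n - real k + 1 / 2) * a n" "e \<noteq> 0"
    and "a n0 \<noteq> 0"
    and "finite Z" "Z \<subseteq> {x. 0 < x \<and> (\<Sum>n. a n * x ^ n) = 0}"
  shows "card Z \<le> length xs"
  using assms
proof (induction xs arbitrary: a Z)
  case Nil
  have "(\<Sum>n. a n * x ^ n) \<noteq> 0" if "0 < x" for x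
  proof -
    have "0 \<le> e * (a n * x ^ n)" for n
      using mult_nonneg_nonneg[OF Nil(2)[of n], of "x ^ n"] that by (simp add: mult.assoc)
    moreover have "e * (a n0 * x ^ n0) \<noteq> 0" using Nil(3,4) that by simp
    ultimately have "0 < e * (a n0 * x ^ n0)" by (metis less_le)
    then have "0 < (\<Sum>n. e * (a n * x ^ n))"
      using suminf_pos2[OF summable_mult[OF Nil(1)], of e x n0] \<open>\<And>n. 0 \<le> e * (a n * x ^ n)\<close> by blast
    also have "\<dots> = e * (\<Sum>n. a n * x ^ n)" by (intro suminf_mult Nil(1))
    finally show ?thesis by auto
  qed
  then have "Z = {}" using Nil(6) by blast
  then show ?case by simp
next
  case (Cons N xs)
  \<comment> \<open>With this exponent \<open>n - \<alpha>\<close> is exactly the factor that the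
    root \<open>N\<close> contributes, so it moves from the product into the coefficients
    \<open>b\<close>.\<close>
  define \<alpha> where "\<alpha> = real N - 1 / 2"
  define f where "f x = (\<Sum>n. a n * x ^ n)" for x
  define f' where "f' x = (\<Sum>n. diffs a n * x ^ n)" for x
  define b where "b n = (real n - \<alpha>) * a n" for n
  have df: "(f has_real_derivative f' x) (at x)" for x
    unfolding f_def f'_def using termdiffs_strong[OF Cons.prems(1)[of "\<bar>x\<bar> + 1"], of x] by simp
  have s: "(\<lambda>n. real n * a n * x ^ n) sums (x * f' x)" for x
  proof -
    have "summable (\<lambda>n. diffs a n * x ^ n)"
      by (rule termdiff_converges_all) (rule Cons.prems)
    from diffs_equiv[OF this] have "(\<lambda>n. real n * a n * x ^ (n - Suc 0)) sums f' x"
      by (simp add: f'_def)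
    from sums_mult[OF this, of x] show ?thesis
    proof (rule sums_cong[THEN iffD1, rotated])
      show "x * (real n * a n * x ^ (n - Suc 0)) = real n * a n * x ^ n" for n
        by (cases n) auto
    qed
  qed
  have bs: "(\<lambda>n. b n * x ^ n) sums (x * f' x - \<alpha> * f x)" for x
    using sums_diff[OF s[of x] sums_mult[OF summable_sums[OF Cons.prems(1)[of x]], of \<alpha>]]
    by (simp add: b_def f_def algebra_simps)
  \<comment> \<open>The power of \<open>x\<close> in front is positive, so the zeros of this
    derivative on the positive axis are those of the series with coefficients
    \<open>b\<close>.\<close>
  have "((\<lambda>x. x powr - \<alpha> * f x) has_real_derivative
      x powr (- \<alpha> - 1) * (x * f' x - \<alpha> * f x)) (at x)" if "0 < x" for x
  proof -
    have "x powr - \<alpha> = x powr (- \<alpha> - 1) * x" using that by (simp add: powr_diff)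
    then show ?thesis
      using that by (auto intro!: derivative_eq_intros df simp: algebra_simps)
  qed
  moreover have "Z \<subseteq> {x. 0 < x \<and> x powr - \<alpha> * f x = 0}" using Cons.prems(6) by (auto simp: f_def)
  ultimately obtain Z' where Z': "finite Z'" "card Z \<le> Suc (card Z')"
    "Z' \<subseteq> {x. 0 < x \<and> x powr (- \<alpha> - 1) * (x * f' x - \<alpha> * f x) = 0}"
    by (rule Rolle_finite_zeros[OF _ Cons.prems(5)])
  have "card Z' \<le> length xs"
  proof (rule Cons.IH[of b])
    show "summable (\<lambda>n. b n * x ^ n)" for x using bs sums_summable by blast
    show "0 \<le> e * (\<Prod>k\<leftarrow>xs. real n - real k + 1 / 2) * b n" for n
      using Cons.prems(2)[of n] by (simp add: b_def \<alpha>_def algebra_simps)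
    have "real n0 \<noteq> \<alpha>"
    proof
      assume "real n0 = \<alpha>"
      then have "2 * n0 + 1 = 2 * N" unfolding \<alpha>_def by linarith
      then show False by presburger
    qed
    then show "b n0 \<noteq> 0" using Cons.prems(4) by (simp add: b_def)
    show "Z' \<subseteq> {x. 0 < x \<and> (\<Sum>n. b n * x ^ n) = 0}"
      using Z'(3) sums_unique[OF bs] by auto
  qed (use Cons.prems Z' in auto)
  then show ?case using Z' by simp
qed

section \<open>Power series of the modified Bessel functions\<close>

text \<open>The coefficient of \<open>z powi j\<close> in \<open>(z + 2 + 1 / z) ^ n\<close>. The
  guard matters: for \<open>j < - int n\<close> the truncation by \<open>nat\<close> would give
  \<open>(2 * n) choose 0 = 1\<close>.\<close>

definition central_coeff :: "nat \<Rightarrow> int \<Rightarrow> nat" where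
  "central_coeff n j = (if - int n \<le> j then (2 * n) choose nat (j + int n) else 0)"

text \<open>Binomial theorem for \<open>z + 2 + 1 / z = (1 + z)\<^sup>2 / z\<close>. The field is
  left general so that the norms, with \<open>norm z\<close> for \<open>z\<close>, can be summed by
  the same formula.\<close>

lemma has_sum_central_coeff:
  fixes z :: "'a::real_normed_field"
  assumes "z \<noteq> 0"
  shows "((\<lambda>j. of_nat (central_coeff n j) * z powi j) has_sum (z + 2 + 1 / z) ^ n) UNIV"
proof -
  define A where "A = (\<lambda>k. int k - int n) ` {..2 * n}"
  have "z + 2 + 1 / z = (1 + z)\<^sup>2 / z"
    using assms by (simp add: power2_eq_square field_simps)
  then have "(z + 2 + 1 / z) ^ n = (z + 1) ^ (2 * n) * z powi - int n"
    by (simp add: power_divide power_mult power_int_minus divide_inverse add.commute power_mult_distrib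
        power_inverse)
  also have "\<dots> = (\<Sum>k\<le>2 * n. of_nat ((2 * n) choose k) * z powi (int k - int n))"
    using assms unfolding binomial_ring
    by (simp add: sum_distrib_left power_int_diff power_int_minus divide_inverse mult_ac)
  also have "\<dots> = (\<Sum>j\<in>A. of_nat (central_coeff n j) * z powi j)"
    unfolding A_def by (subst sum.reindex) (auto simp: inj_on_def central_coeff_def)
  finally have eq: "(z + 2 + 1 / z) ^ n = (\<Sum>j\<in>A. of_nat (central_coeff n j) * z powi j)" .
  have "central_coeff n j = 0" if "j \<notin> A" for j
  proof (cases "- int n \<le> j")
    case True
    then have "j = int (nat (j + int n)) - int n" by simp
    with that have "nat (j + int n) \<notin> {..2 * n}" unfolding A_def by blast
    then show ?thesis by (simp add: central_coeff_def binomial_eq_0)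
  qed (simp add: central_coeff_def)
  then have "((\<lambda>j. of_nat (central_coeff n j) * z powi j) has_sum (z + 2 + 1 / z) ^ n) UNIV \<longleftrightarrow>
      ((\<lambda>j. of_nat (central_coeff n j) * z powi j) has_sum (z + 2 + 1 / z) ^ n) A"
    by (intro has_sum_cong_neutral) auto
  moreover have "finite A" by (simp add: A_def)
  ultimately show ?thesis unfolding eq using has_sum_finite by blast
qed

lemma exp_has_sum:
  fixes w :: "'a::{real_normed_field,banach}"
  shows "((\<lambda>n. w ^ n / fact n) has_sum exp w) UNIV"
proof (rule norm_summable_imp_has_sum)
  show "summable (\<lambda>n. norm (w ^ n / fact n))"
    using summable_norm_exp[of w] by (simp add: scaleR_conv_of_real divide_simps)
  show "(\<lambda>n. w ^ n / fact n) sums exp w"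
    using exp_converges[of w] by (simp add: scaleR_conv_of_real divide_simps)
qed

text \<open>Multiplying the generating function by \<open>exp x\<close> turns its exponent into
  \<open>x / 2 * (1 + z)\<^sup>2 / z\<close>, whose expansion does not separate the indices \<open>n\<close> by parity.\<close>

lemma exp_mult_bessel_I_sums:
  fixes x :: real
  shows "(\<lambda>n. (x / 2) ^ n / fact n * real (central_coeff n j)) sums (exp x * bessel_I j x)"
proof -
  define g where "g n j = (x / 2) ^ n / fact n * real (central_coeff n j)" for n j
  have main: "((\<lambda>(j, n). of_real (g n j) * z powi j) has_sum
      exp (of_real x) * exp (of_real x / 2 * (z + 1 / z))) (UNIV \<times> UNIV)" if z: "z \<noteq> 0" for z :: complex
  proof -
    define f where "f = (\<lambda>(n, j). of_real (g n j) * z powi j)"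
    define w where "w = of_real x / 2 * (z + 2 + 1 / z)"
    \<comment> \<open>The central coefficients are nonnegative, so the norms form the same double
      series with \<open>\<bar>x\<bar>\<close> and \<open>norm z\<close>; this gives absolute
      summability.\<close>
    define r where "r = \<bar>x\<bar> / 2 * (norm z + 2 + 1 / norm z)"
    have f: "f (n, j) = of_real ((x / 2) ^ n / fact n) * (of_nat (central_coeff n j) * z powi j)" for n j
      by (simp add: f_def g_def)
    have inner: "((\<lambda>j. f (n, j)) has_sum w ^ n / fact n) UNIV" for n
      using has_sum_cmult_right[OF has_sum_central_coeff[OF z, of n], of "of_real ((x / 2) ^ n / fact n)"]
      unfolding f w_def by (simp add: power_mult_distrib power_divide)
    have norm_inner: "((\<lambda>j. norm (f (n, j))) has_sum r ^ n / fact n) UNIV" for n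
    proof -
      have "norm (f (n, j)) = (\<bar>x\<bar> / 2) ^ n / fact n * (of_nat (central_coeff n j) * norm z powi j)" for j
        unfolding f by (simp add: norm_mult norm_divide norm_power norm_power_int power_abs)
      moreover have "r ^ n / fact n = (\<bar>x\<bar> / 2) ^ n / fact n * (norm z + 2 + 1 / norm z) ^ n"
        unfolding r_def power_mult_distrib by simp
      ultimately show ?thesis
        using has_sum_cmult_right[OF has_sum_central_coeff[of "norm z" n], of "(\<bar>x\<bar> / 2) ^ n / fact n"] z
        by simp
    qed
    have "(\<lambda>p. norm (f p)) summable_on UNIV \<times> UNIV"
      unfolding Infinite_Sum.abs_summable_on_Sigma_iff
    proof (intro conjI ballI)
      show "(\<lambda>j. norm (f (n, j))) summable_on UNIV" for n
        using norm_inner has_sum_imp_summable by blast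
      have "0 \<le> r" unfolding r_def by simp
      then have "norm (\<Sum>\<^sub>\<infinity>j. norm (f (n, j))) = r ^ n / fact n" for n
        by (simp add: infsumI[OF norm_inner])
      then show "(\<lambda>n. norm (\<Sum>\<^sub>\<infinity>j. norm (f (n, j)))) summable_on UNIV"
        using exp_has_sum[of r] by (auto simp: summable_on_def)
    qed
    then have "f summable_on UNIV \<times> UNIV"
      by (rule abs_summable_summable)
    then have "(f has_sum infsum f (UNIV \<times> UNIV)) (UNIV \<times> UNIV)" by (rule has_sum_infsum)
    moreover from has_sum_SigmaD[OF this inner] have "((\<lambda>n. w ^ n / fact n) has_sum infsum f (UNIV \<times> UNIV)) UNIV" .
    then have "infsum f (UNIV \<times> UNIV) = exp w"
      using exp_has_sum has_sum_unique by blast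
    moreover have "w = of_real x + of_real x / 2 * (z + 1 / z)"
      by (simp add: w_def algebra_simps)
    ultimately have "(f has_sum exp (of_real x) * exp (of_real x / 2 * (z + 1 / z))) (UNIV \<times> UNIV)"
      by (simp only: exp_add)
    then show ?thesis
      by (subst has_sum_swap) (simp add: f_def)
  qed
  have g_sum: "(\<lambda>n. g n j) summable_on UNIV" for j
  proof -
    \<comment> \<open>The point \<open>z = 1\<close> isolates the coefficients.\<close>
    have "(\<lambda>(j, n). complex_of_real (g n j) * 1 powi j) summable_on UNIV \<times> UNIV"
      by (rule has_sum_imp_summable[OF main]) simp
    then have "(\<lambda>n. complex_of_real (g n j)) summable_on UNIV"
      using summable_on_SigmaD1[of "\<lambda>j n. complex_of_real (g n j) * 1 powi j" UNIV "\<lambda>_. UNIV" j]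
      by simp
    then show ?thesis using summable_on_Re by fastforce
  qed
  \<comment> \<open>These satisfy the generating identity, so uniqueness of the coefficients
    identifies them with the Bessel values.\<close>
  define c where "c j = exp (- x) * infsum (\<lambda>n. g n j) UNIV" for j
  have "is_bessel_I_coeffs x c"
    unfolding is_bessel_I_coeffs_def
  proof (intro allI impI)
    fix z :: complex assume z: "z \<noteq> 0"
    have "((\<lambda>n. of_real (g n j) * z powi j) has_sum of_real (infsum (\<lambda>n. g n j) UNIV) * z powi j) UNIV" for j
      by (intro has_sum_cmult_left has_sum_of_real has_sum_infsum g_sum)
    then have "((\<lambda>j. of_real (infsum (\<lambda>n. g n j) UNIV) * z powi j) has_sum
        exp (of_real x) * exp (of_real x / 2 * (z + 1 / z))) UNIV"
      using has_sum_SigmaD[OF main[OF z]] by simp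
    moreover have "of_real (exp (- x)) * (exp (of_real x) * w) = w" for w :: complex
      by (simp add: exp_minus exp_of_real[symmetric] mult.assoc[symmetric])
    ultimately show "((\<lambda>j. of_real (c j) * z powi j) has_sum exp (of_real x / 2 * (z + 1 / z))) UNIV"
      using has_sum_cmult_right[of _ _ _ "complex_of_real (exp (- x))"]
      unfolding c_def of_real_mult mult.assoc by metis
  qed
  then have "bessel_I j x = c j"
    using bessel_I_coeffs bessel_I_coeffs_ex1 by metis
  then have "exp x * bessel_I j x = infsum (\<lambda>n. g n j) UNIV"
    by (simp add: c_def exp_minus)
  then show ?thesis
    using has_sum_imp_sums[OF has_sum_infsum[OF g_sum[of j]]] by (simp add: g_def)
qed

definition bessel_weight :: "nat \<Rightarrow> real" where
  "bessel_weight n = fact (2 * n) / fact n ^ 3"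

lemma bessel_weight_pos: "0 < bessel_weight n"
  by (simp add: bessel_weight_def)

text \<open>For \<open>j \<le> n\<close> the ratio is
  \<open>n!\<^sup>2 / ((n - j)! (n + j)!)\<close> and the coefficient is
  \<open>(2n)! / ((n - j)! (n + j)!)\<close>; for \<open>j > n\<close> both vanish.\<close>

lemma central_coeff_falling_ratio:
  "real (central_coeff n (int j)) / fact n = bessel_weight n * falling_ratio 1 j n"
proof (cases "j \<le> n")
  case True
  have "falling_ratio 1 j n = fact n * fact n / (fact (n - j) * fact (n + j))"
    using True
  proof (induction j)
    case (Suc j)
    then have "n - j = Suc (n - Suc j)" by simp
    then have "(fact (n - j) :: real) = (real n - real j) * fact (n - Suc j)"
      using Suc.prems by (simp add: of_nat_diff)
    moreover have "real n - real j \<noteq> 0" using Suc.prems by simp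
    moreover have "falling_ratio 1 (Suc j) n = falling_ratio 1 j n * ((real n - real j) / (real n + 1 + real j))"
      by (simp add: falling_ratio_def)
    ultimately show ?case
      using Suc by (simp add: add_ac)
  qed (simp add: falling_ratio_def)
  moreover have "real (central_coeff n (int j)) = fact (2 * n) / (fact (n - j) * fact (n + j))"
  proof -
    have "2 * n - (j + n) = n - j" by simp
    then show ?thesis
      using True binomial_fact[of "j + n" "2 * n", where ?'a = real]
      by (simp add: central_coeff_def nat_add_distrib add_ac mult_ac)
  qed
  ultimately show ?thesis by (simp add: bessel_weight_def power3_eq_cube)
next
  case False
  then show ?thesis
    by (simp add: central_coeff_def nat_add_distrib falling_ratio_eq_0 binomial_eq_0)
qed

lemma bessel_I_sums:
  "(\<lambda>n. bessel_weight n * falling_ratio 1 j n * (x / 2) ^ n) sums (exp x * bessel_I (int j) x)"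
  using exp_mult_bessel_I_sums[of x "int j"]
  by (simp add: central_coeff_falling_ratio[symmetric] mult_ac)

section \<open>Positivity of the determinants\<close>

lemma bessel_I_sum_sums:
  "(\<lambda>n. bessel_weight n * (\<Sum>l\<le>m. c l * falling_ratio 1 (y l) n) * (x / 2) ^ n) sums
    (exp x * (\<Sum>l\<le>m. c l * bessel_I (int (y l)) x))"
proof -
  have "(\<lambda>n. \<Sum>l\<le>m. c l * (bessel_weight n * falling_ratio 1 (y l) n * (x / 2) ^ n)) sums
      (\<Sum>l\<le>m. c l * (exp x * bessel_I (int (y l)) x))"
    by (intro sums_sum sums_mult bessel_I_sums)
  then show ?thesis by (simp add: sum_distrib_left sum_distrib_right mult_ac)
qed

lemma continuous_bessel_I: "isCont (bessel_I (int j)) x"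
proof -
  define a where "a n = bessel_weight n * falling_ratio 1 j n" for n
  have s: "(\<lambda>n. a n * t ^ n) sums (exp (2 * t) * bessel_I (int j) (2 * t))" for t
    using bessel_I_sums[of j "2 * t"] by (simp add: a_def)
  have "isCont (\<lambda>t. \<Sum>n. a n * t ^ n) t" for t
    by (rule isCont_powser_converges_everywhere) (use s sums_summable in blast)
  then have "isCont (\<lambda>x. \<Sum>n. a n * (x / 2) ^ n) x"
    by (rule isCont_o2[rotated]) (intro continuous_intros, simp)
  then have "isCont (\<lambda>x. exp (- x) * (\<Sum>n. a n * (x / 2) ^ n)) x"
    by (intro continuous_mult continuous_exp continuous_minus continuous_ident)
  moreover have "bessel_I (int j) = (\<lambda>x. exp (- x) * (\<Sum>n. a n * (x / 2) ^ n))"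
    using sums_unique[OF s, of "_ / 2", symmetric] by (simp add: fun_eq_iff exp_minus)
  ultimately show ?thesis by simp
qed

text \<open>Only the term \<open>l = 0\<close> contributes to the coefficient at \<open>y 0\<close>,
  and no term contributes below it. Thus \<open>0 < c 0\<close> makes the lowest coefficient
  positive, which gives both the nontriviality required by the rule of signs and the sign near
  \<open>0\<close>.\<close>

lemma
  fixes c :: "nat \<Rightarrow> real"
  assumes y: "strict_mono_on {..m} y" and c: "0 < c 0"
  shows card_zeros_bessel_I_sum: "finite Z \<Longrightarrow>
      Z \<subseteq> {x. 0 < x \<and> (\<Sum>l\<le>m. c l * bessel_I (int (y l)) x) = 0} \<Longrightarrow> card Z \<le> m"
    and bessel_I_sum_pos_near_0: "0 < b \<Longrightarrow>
      \<exists>x. 0 < x \<and> x < b \<and> 0 < (\<Sum>l\<le>m. c l * bessel_I (int (y l)) x)"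
proof -
  define F where "F x = (\<Sum>l\<le>m. c l * bessel_I (int (y l)) x)" for x
  define q where "q n = (\<Sum>l\<le>m. c l * falling_ratio 1 (y l) n)" for n
  define a where "a n = bessel_weight n * q n" for n
  define k where "k = y 0"
  have s: "(\<lambda>n. a n * t ^ n) sums (exp (2 * t) * F (2 * t))" for t
    using bessel_I_sum_sums[of c y m "2 * t"] by (simp add: a_def q_def F_def)
  have y0: "k < y l" if "l \<in> {..m} - {0}" for l
    using y that by (auto simp: k_def strict_mono_on_def)
  have q_k: "q k = c 0 * falling_ratio 1 k k"
  proof -
    have "q k = c 0 * falling_ratio 1 (y 0) k + (\<Sum>l\<in>{..m} - {0}. c l * falling_ratio 1 (y l) k)"
      unfolding q_def by (subst sum.remove[of _ 0]) auto
    also have "(\<Sum>l\<in>{..m} - {0}. c l * falling_ratio 1 (y l) k) = 0"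
      using y0 by (intro sum.neutral) (auto simp: falling_ratio_eq_0)
    finally show ?thesis by (simp add: k_def)
  qed
  then have a_k: "0 < a k"
    using c by (simp add: a_def bessel_weight_pos falling_ratio_pos)
  have a_less: "a n = 0" if "n < k" for n
  proof -
    have "n < y l" if "l \<le> m" for l
      using y0[of l] that \<open>n < k\<close> by (cases "l = 0") (auto simp: k_def)
    then show ?thesis by (auto simp: a_def q_def falling_ratio_eq_0)
  qed
  show "card Z \<le> m" if Z: "finite Z" "Z \<subseteq> {x. 0 < x \<and> (\<Sum>l\<le>m. c l * bessel_I (int (y l)) x) = 0}"
  proof -
    have "sign_changes_le m a"
      unfolding a_def q_def
      by (intro sign_changes_le_mult_pos bessel_weight_pos sign_changes_falling_ratio_sum y) simp
    then obtain xs :: "nat list" and e :: real where xs: "length xs \<le> m"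
      "\<And>n. 0 \<le> e * (\<Prod>k\<leftarrow>xs. real n - real k + 1 / 2) * a n" "e \<noteq> 0"
      by (rule sign_changes_le_polynomial) blast
    \<comment> \<open>The power series has the variable \<open>x / 2\<close>, so the zeros are
      halved.\<close>
    have "card ((\<lambda>x. x / 2) ` Z) \<le> length xs"
    proof (rule Descartes_powser[OF _ xs(2,3), of k])
      show "summable (\<lambda>n. a n * t ^ n)" for t using s sums_summable by blast
      show "(\<lambda>x. x / 2) ` Z \<subseteq> {t. 0 < t \<and> (\<Sum>n. a n * t ^ n) = 0}"
        using Z(2) by (auto simp: sums_unique[OF s, symmetric] F_def)
    qed (use a_k Z in auto)
    moreover have "card ((\<lambda>x. x / 2) ` Z) = card Z"
      by (intro card_image) (auto simp: inj_on_def)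
    ultimately show ?thesis using xs(1) by simp
  qed
  show "\<exists>x. 0 < x \<and> x < b \<and> 0 < (\<Sum>l\<le>m. c l * bessel_I (int (y l)) x)" if b: "0 < b"
  proof -
    \<comment> \<open>The series with \<open>t ^ k\<close> divided out, so that
      \<open>G 0 = a k\<close> is positive.\<close>
    define G where "G t = (\<Sum>n. a (n + k) * t ^ n)" for t
    have sa: "summable (\<lambda>n. a n * t ^ n)" for t using s sums_summable by blast
    have sk: "summable (\<lambda>n. a (n + k) * t ^ n)" for t
    proof (cases "t = 0")
      case False
      have "summable (\<lambda>n. a (n + k) * t ^ (n + k))"
        using sa[of t] summable_iff_shift[of "\<lambda>n. a n * t ^ n" k] by simp
      then have "summable (\<lambda>n. t ^ k * (a (n + k) * t ^ n))" by (simp add: power_add mult_ac)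
      then show ?thesis using False by simp
    qed simp
    have "isCont G 0"
      unfolding G_def by (rule isCont_powser_converges_everywhere) (rule sk)
    moreover have "0 < G 0" using a_k by (simp add: G_def)
    ultimately have "eventually (\<lambda>t. 0 < G t) (at 0)"
      unfolding isCont_def by (rule order_tendstoD)
    then obtain d where d: "0 < d" "\<And>t. t \<noteq> 0 \<Longrightarrow> \<bar>t\<bar> < d \<Longrightarrow> 0 < G t"
      unfolding eventually_at by (auto simp: dist_real_def)
    define t where "t = min d b / 4"
    have t: "0 < t" "t < d" "2 * t < b" using d b by (auto simp: t_def)
    have "exp (2 * t) * F (2 * t) = (\<Sum>n. a n * t ^ n)" by (rule sums_unique[OF s])
    also have "\<dots> = (\<Sum>n. a (n + k) * t ^ (n + k)) + (\<Sum>n<k. a n * t ^ n)"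
      by (rule suminf_split_initial_segment[OF sa])
    also have "\<dots> = t ^ k * G t"
      unfolding G_def using suminf_mult[OF sk, of "t ^ k" t] by (simp add: a_less power_add mult_ac)
    also have "0 < t ^ k * G t" using t d(2)[of t] by simp
    finally have "0 < F (2 * t)" by (simp add: zero_less_mult_iff)
    then show ?thesis using t by (intro exI[of _ "2 * t"]) (auto simp: F_def)
  qed
qed

lemma bessel_I_det_pos:
  fixes x :: "nat \<Rightarrow> real" and y :: "nat \<Rightarrow> nat"
  assumes "\<And>i. i < m \<Longrightarrow> 0 < x i" "strict_mono_on {..<m} x" "strict_mono_on {..<m} y"
  shows "0 < Determinant.det (mat m m (\<lambda>(i, j). bessel_I (int (y j)) (x i)))"
  using assms
proof (induction m arbitrary: x y)
  case 0
  show ?case by (simp add: det_dim_zero)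
next
  case (Suc m)
  define M where "M t = mat (Suc m) (Suc m) (\<lambda>(i, j). bessel_I (int (y j)) (if i = 0 then t else x i))" for t
  \<comment> \<open>Cofactors along row \<open>0\<close> do not depend on the argument in that row;
    the \<open>0\<close> in \<open>M 0\<close> is a placeholder.\<close>
  define c where "c l = cofactor (M 0) 0 l" for l
  define F where "F t = (\<Sum>l\<le>m. c l * bessel_I (int (y l)) t)" for t
  have M_carrier: "M t \<in> carrier_mat (Suc m) (Suc m)" for t by (simp add: M_def)
  have det_M: "Determinant.det (M t) = F t" for t
  proof -
    have "mat_delete (M t) 0 l = mat_delete (M 0) 0 l" if "l < Suc m" for l
      by (rule eq_matI) (auto simp: M_def mat_delete_def)
    then show ?thesis
      using laplace_expansion_row[OF M_carrier, of 0 t]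
      by (simp add: F_def c_def cofactor_def M_def mult.commute lessThan_Suc_atMost)
  qed
  have x_less: "x i < x j" if "i < j" "j \<le> m" for i j
    using Suc.prems(2) that by (auto simp: strict_mono_on_def)
  have "0 < Determinant.det (mat m m (\<lambda>(i, j). bessel_I (int (y (Suc j))) (x (Suc i))))"
    using Suc.prems by (intro Suc.IH) (auto simp: strict_mono_on_def)
  also have "mat m m (\<lambda>(i, j). bessel_I (int (y (Suc j))) (x (Suc i))) = mat_delete (M 0) 0 0"
    by (rule eq_matI) (auto simp: M_def mat_delete_def)
  finally have c0: "0 < c 0" by (simp add: c_def cofactor_def)
  have y: "strict_mono_on {..m} y" using Suc.prems(3) by (simp add: lessThan_Suc_atMost)
  define Z where "Z = x ` {1..m}"
  have "inj_on x {1..m}"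
  proof (rule linorder_inj_onI)
    show "x i \<noteq> x j" if "i < j" "i \<in> {1..m}" "j \<in> {1..m}" for i j
      using x_less[of i j] that by simp
  qed auto
  then have card_Z: "finite Z" "card Z = m" by (simp_all add: Z_def card_image)
  have Z_zero: "F z = 0" if z: "z \<in> Z" for z
  proof -
    obtain i where i: "1 \<le> i" "i \<le> m" "z = x i" using z by (auto simp: Z_def)
    have "Determinant.det (M z) = 0"
      by (rule det_identical_rows[OF M_carrier, of 0 i]) (use i in \<open>auto simp: M_def\<close>)
    then show ?thesis by (simp add: det_M)
  qed
  have Z_gt: "x 0 < z" if "z \<in> Z" for z using that x_less by (auto simp: Z_def)
  have x0: "0 < x 0" using Suc.prems(1) by simp
  \<comment> \<open>Together with the \<open>m\<close> points of \<open>Z\<close>, where two rows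
    coincide, \<open>t\<close> would be zero number \<open>m + 1\<close>.\<close>
  have no_zero: "F t \<noteq> 0" if "0 < t" "t \<le> x 0" for t
  proof
    assume "F t = 0"
    then have "card (insert t Z) \<le> m"
      using that card_Z Z_zero Z_gt x0
      by (intro card_zeros_bessel_I_sum[where c = c, OF y c0]) (auto simp: F_def[symmetric] intro: less_trans[OF x0 Z_gt])
    moreover have "t \<notin> Z" using Z_gt that by force
    ultimately show False using card_Z by simp
  qed
  obtain t where t: "0 < t" "t < x 0" "0 < F t"
    using bessel_I_sum_pos_near_0[where c = c, OF y c0 x0] unfolding F_def by blast
  have "0 < F (x 0)"
  proof (rule ccontr)
    assume "\<not> 0 < F (x 0)"
    moreover have "\<forall>s. t \<le> s \<and> s \<le> x 0 \<longrightarrow> isCont F s"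
      unfolding F_def by (intro allI impI continuous_intros continuous_bessel_I)
    ultimately obtain s where "t \<le> s" "s \<le> x 0" "F s = 0"
      using IVT2[of F "x 0" 0 t] t by auto
    then show False using no_zero[of s] t by simp
  qed
  then have "0 < Determinant.det (M (x 0))" by (simp add: det_M)
  also have "M (x 0) = mat (Suc m) (Suc m) (\<lambda>(i, j). bessel_I (int (y j)) (x i))"
    by (rule eq_matI) (auto simp: M_def)
  finally show ?case .
qed

theorem theorem1p4:
  fixes r :: nat
  shows "strictly_totally_positive_kernel r {x::real. 0 < x} {j::int. 0 \<le> j} (\<lambda>x j. bessel_I j x)"
  unfolding strictly_totally_positive_kernel_def
proof (intro allI impI)
  fix m :: nat and x :: "nat \<Rightarrow> real" and y :: "nat \<Rightarrow> int"
  assume A: "1 \<le> m \<and> m \<le> r \<and> x ` {..<m} \<subseteq> {x. 0 < x} \<and> strict_mono_on {..<m} x \<and>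
    y ` {..<m} \<subseteq> {j. 0 \<le> j} \<and> strict_mono_on {..<m} y"
  then have y: "0 \<le> y i" if "i < m" for i using that by auto
  have "0 < Determinant.det (mat m m (\<lambda>(i, j). bessel_I (int (nat (y j))) (x i)))"
  proof (rule bessel_I_det_pos)
    show "strict_mono_on {..<m} (\<lambda>i. nat (y i))"
    proof (rule strict_mono_onI)
      fix i j assume ij: "i \<in> {..<m}" "j \<in> {..<m}" "i < j"
      then have "y i < y j" using A by (auto simp: strict_mono_on_def)
      then show "nat (y i) < nat (y j)" using y[of i] ij by simp
    qed
  qed (use A in auto)
  also have "mat m m (\<lambda>(i, j). bessel_I (int (nat (y j))) (x i)) = mat m m (\<lambda>(i, j). bessel_I (y j) (x i))"
    by (rule eq_matI) (auto simp: y)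
  finally show "0 < Determinant.det (mat m m (\<lambda>(i, j). bessel_I (y j) (x i)))" .
qed

end
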